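(* Let $\{\epsilon_l\}_{l\in\mathbb N}$ be a sequence of positive reals and $\{k_l\},\{n_l\}$ sequences in $\mathbb N$. For each $l$ let $\mathcal U_l$ be a family of open subsets of $X$, let $A_l\in\bigvee_{i=0}^{k_l-1}T^{-in_l}\mathcal U_l$, let $\mathcal P_l$ be a (finite) locally $\epsilon_l$-independent set with respect to $A_l$ (with parameters $k_l,n_l$), and let $h_{l,i}:P\to\mathbb R$, $1\leqslant i\leqslant k_l$, be functions. Put $a_i=(i-1)n_l$ and $s_l^2=\sum_{i=1}^{k_l}\sigma^2_{\mathcal P_l}(S^{n_l}_{a_i}h_{l,i})$, and assume $$\lim_{l\to\infty}\frac1{s_l^j}\sum_{i=1}^{k_l}\int\left(\omega_{a_i}^{n_l}(h_{l,i},\epsilon_l,p)\right)^jd\nu_{\mathcal P_l}(p)=0,\qquad j=1,2.$$ Then the Lindeberg condition $$\lim_{l\to\infty}\frac1{s_l^2}\sum_{i=1}^{k_l}L_{\mathcal P_l}(S^{n_l}_{a_i}h_{l,i},\eta s_l)=0\qquad\text{for all }\eta>0$$ holds if and only if both of the following hold: (i) (asymptotic negligibility) for all $\eta>0$, $$\lim_{l\to\infty}\max_{1\leqslant i\leqslant k_l}\nu_{\mathcal P_l}\left(\left\{\left|S^{n_l}_{a_i}h_{l,i}-\mathbb E_{\mathcal P_l}(S^{n_l}_{a_i}h_{l,i})\right|\geqslant\eta s_l\right\}\right)=0;$$ (ii) (CLT) for every $t\in\mathbb R$, $$\lim_{l\to\infty}\nu_{\mathcal P_l}\left(\left\{\sum_{i=1}^{k_l}\left(S^{n_l}_{a_i}h_{l,i}-\mathbb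 E_{\mathcal P_l}(S^{n_l}_{a_i}h_{l,i})\right)\leqslant ts_l\right\}\right)=\mathcal N(t).$$
   Context: $(X,d)$ is a compact metric space and $T:X\to X$ is continuous. $P_n=\{x\in X:T^nx=x\}$, $P=\bigcup_nP_n$; each $P_n$ is finite. $d_n(x,y)=\sup_{0\leqslant k\leqslant n-1}d(T^kx,T^ky)$, $B^n_\epsilon(x)=\{y\in X:d_n(x,y)<\epsilon\}$. For a family $\mathcal U$ of sets, $\bigvee_{i=0}^{k-1}T^{-in}\mathcal U$ is the family of sets $\bigcap_{i=0}^{k-1}T^{-in}U_i$ with $U_i\in\mathcal U$. Local $\epsilon$-independence: let $\epsilon>0$, $\mathcal U$ a family of open sets, and $A\in\bigvee_{i=0}^{k-1}T^{-in}\mathcal U$ for some $k,n\in\mathbb N$. A subset $\mathcal P\subset P$ is locally $\epsilon$-independent with respect to $A$ if there exist $E_i\subset T^{(i-1)n}A$, $1\leqslant i\leqslant k$, and a bijection $\Phi:\prod_{i=1}^kE_i\to\mathcal P$ such that $T^{(i-1)n}(\Phi(\mathbf x))\in B^n_\epsilon(x_i)$ for all $\mathbf x=(x_1,\dots,x_k)\in\prod_{i=1}^kE_i$ and $1\leqslant i\leqslant k$. For a finite set $Z\subset X$, $\nu_Z$ is the uniform probability on $Z$, and $\mathbb E_Z$, $\sigma_Z^2$ are expectation and variance with respect to $\nu_Z$. $L_Z(h,\eta)=\int(h-\mathbb E_Z(h))^2\,\mathbb 1_{\{|h-\mathbb E_Z(h)|>\eta\}}\,d\nu_Z$. $S_m^nh(x)=\sum_{i=m}^{m+n-1}h(T^ix)$,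 $S^nh=S^n_0h$. For $h:P\to\mathbb R$, $\omega_m^n(h,\epsilon,x)=\sup\{|S_m^nh(x)-S^nh(y)|:y\in B^n_\epsilon(T^mx)\cap P\}$. $\mathcal N(t)=\frac1{\sqrt{2\pi}}\int_{-\infty}^te^{-u^2/2}du$. It is understood that $s_l>0$.
   Formalization: The formal theorem additionally assumes that the sets E_i in the definition of local ε_l-independence consist of periodic points (E_i ⊂ P); without this the claim fails, since the oscillation only compares with points of P and can vanish while the CLT fails. *)

theory Defs
  imports "HOL-Probability.Probability"
begin

definition periodic_pts :: "('a \<Rightarrow> 'a) \<Rightarrow> nat \<Rightarrow> 'a set" where
  "periodic_pts T n = {x. (T ^^ n) x = x}"

definition Per :: "('a \<Rightarrow> 'a) \<Rightarrow> 'a set" where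
  "Per T = (\<Union>n\<in>{1..}. periodic_pts T n)"

(* Only used for n \<ge> 1: for n = 0 the supremum over the empty set is unspecified. *)
definition bowen_dist :: "('a::metric_space \<Rightarrow> 'a) \<Rightarrow> nat \<Rightarrow> 'a \<Rightarrow> 'a \<Rightarrow> real" where
  "bowen_dist T n x y = (SUP j\<in>{..<n}. dist ((T ^^ j) x) ((T ^^ j) y))"

definition bowen_ball :: "('a::metric_space \<Rightarrow> 'a) \<Rightarrow> nat \<Rightarrow> real \<Rightarrow> 'a \<Rightarrow> 'a set" where
  "bowen_ball T n \<epsilon> x = {y. bowen_dist T n x y < \<epsilon>}"

definition join_family :: "('a \<Rightarrow> 'a) \<Rightarrow> nat \<Rightarrow> nat \<Rightarrow> 'a set set \<Rightarrow> 'a set set" where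
  "join_family T n k \<U> = {\<Inter>i<k. (T ^^ (i * n)) -` V i | V. \<forall>i<k. V i \<in> \<U>}"

(* "Q is locally independent" means that this holds for some E. The sets E i are exposed as
   a parameter because they need not consist of periodic points: for functions h defined
   only on the periodic points, Birkhoff sums of h at points of E i make sense only under
   the additional hypothesis E i \<subseteq> Per T. *)
definition locally_independent ::
  "('a::metric_space \<Rightarrow> 'a) \<Rightarrow> real \<Rightarrow> nat \<Rightarrow> nat \<Rightarrow> 'a set \<Rightarrow> (nat \<Rightarrow> 'a set) \<Rightarrow> 'a set \<Rightarrow> bool" where
  "locally_independent T \<epsilon> n k A E Q \<longleftrightarrow>
     Q \<subseteq> Per T \<and>
     (\<forall>i\<in>{1..k}. E i \<subseteq> (T ^^ ((i - 1) * n)) ` A) \<and>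
     (\<exists>\<Phi>. bij_betw \<Phi> (PiE {1..k} E) Q \<and>
          (\<forall>x\<in>PiE {1..k} E. \<forall>i\<in>{1..k}.
             (T ^^ ((i - 1) * n)) (\<Phi> x) \<in> bowen_ball T n \<epsilon> (x i)))"

(* pmf_of_set Z is unspecified unless Z is finite and nonempty. *)
abbreviation unif_prob :: "'a set \<Rightarrow> 'a set \<Rightarrow> real" where
  "unif_prob Z \<equiv> measure_pmf.prob (pmf_of_set Z)"

abbreviation unif_expectation :: "'a set \<Rightarrow> ('a \<Rightarrow> real) \<Rightarrow> real" where
  "unif_expectation Z f \<equiv> measure_pmf.expectation (pmf_of_set Z) f"

abbreviation unif_variance :: "'a set \<Rightarrow> ('a \<Rightarrow> real) \<Rightarrow> real" where
  "unif_variance Z f \<equiv> measure_pmf.variance (pmf_of_set Z) f"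

definition lindeberg_fun :: "'a set \<Rightarrow> ('a \<Rightarrow> real) \<Rightarrow> real \<Rightarrow> real" where
  "lindeberg_fun Z f \<eta> =
     unif_expectation Z (\<lambda>x. (f x - unif_expectation Z f)\<^sup>2 *
       indicator {x. \<bar>f x - unif_expectation Z f\<bar> > \<eta>} x)"

definition birkhoff_sum :: "('a \<Rightarrow> 'a) \<Rightarrow> ('a \<Rightarrow> real) \<Rightarrow> nat \<Rightarrow> nat \<Rightarrow> 'a \<Rightarrow> real" where
  "birkhoff_sum T h m n x = (\<Sum>i=m..<m + n. h ((T ^^ i) x))"

(* A function on the periodic points is represented by a total function h, which is
   evaluated only at points of Per T. As h may be unbounded there and the Bowen ball may
   contain infinitely many periodic points, the supremum is taken in [0, \<infinity>]. *)
definition oscillation ::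
  "('a::metric_space \<Rightarrow> 'a) \<Rightarrow> ('a \<Rightarrow> real) \<Rightarrow> real \<Rightarrow> nat \<Rightarrow> nat \<Rightarrow> 'a \<Rightarrow> ennreal" where
  "oscillation T h \<epsilon> m n x =
     (SUP y\<in>bowen_ball T n \<epsilon> ((T ^^ m) x) \<inter> Per T.
        ennreal \<bar>birkhoff_sum T h m n x - birkhoff_sum T h 0 n y\<bar>)"

end

theory Submission
  imports Defs
begin

text \<open>
  Write \<open>U\<^sub>i = (Y\<^sub>i - E Y\<^sub>i) / s\<close> for the normalised terms of one row. They have mean \<open>0\<close> and their
  second moments sum to \<open>1\<close>, but they are not independent, so the theorem of Lindeberg and Feller does
  not apply to them directly. Its proof, however, uses independence only through the characteristic
  function of the sum, which has to be close to the product of the characteristic functions of the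
  terms. This weaker property can be checked for the \<open>U\<^sub>i\<close> themselves.
  
  Local independence parametrises the periodic points \<open>p \<in> Q\<close> by a product of finite sets \<open>E\<^sub>i\<close>, so
  under the uniform distribution on \<open>Q\<close> the coordinates \<open>x\<^sub>i\<close> of \<open>p\<close> are independent
  (\<open>locally_independent_imp_indep_shadows\<close>). The orbit segment of \<open>p\<close> that \<open>Y\<^sub>i\<close> sums over stays
  \<open>\<epsilon>\<close>-close to the orbit of \<open>x\<^sub>i\<close>, hence \<open>Y\<^sub>i\<close> differs from the Birkhoff sum at \<open>x\<^sub>i\<close> by at most the
  oscillation of \<open>Y\<^sub>i\<close>. The map \<open>u \<mapsto> e\<^sup>i\<^sup>t\<^sup>u\<close> is \<open>\<bar>t\<bar>\<close>-Lipschitz and takes values in the unit circle.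
  Passing from the \<open>U\<^sub>i\<close> to their independent substitutes therefore changes both the characteristic
  function of the sum and the product of the characteristic functions by at most \<open>\<bar>t\<bar>\<close> times the sum of
  the mean oscillations divided by \<open>s\<close> (\<open>char_sum_near_prod_of_indep\<close>), and this tends to \<open>0\<close>.
  
  What remains is the Lindeberg--Feller theorem for arrays with this asymptotic independence
  (\<open>lindeberg_iff\<close>). Let \<open>\<phi>\<^sub>i\<close> be the characteristic function of \<open>U\<^sub>i\<close>. If the terms are negligible,
  then all \<open>\<phi>\<^sub>i(t) - 1\<close> are uniformly small while their moduli have a bounded sum, so the product of
  the \<open>\<phi>\<^sub>i(t)\<close> may be replaced by the exponential of \<open>\<Sum>\<^sub>i (\<phi>\<^sub>i(t) - 1)\<close>
  (\<open>prod_char_minus_exp_sum\<close>). By Levy's continuity theorem the central limit theorem now says that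
  this exponential tends to \<open>exp (-t\<^sup>2/2)\<close>. The Lindeberg condition gives \<open>\<Sum>\<^sub>i (\<phi>\<^sub>i(t) - 1) \<longlonglongrightarrow> -t\<^sup>2/2\<close>
  by a second-order expansion. Conversely, taking moduli of the exponentials yields the real part of
  this convergence, that is, \<open>\<Sum>\<^sub>i E (cos (t U\<^sub>i) - 1 + t\<^sup>2 U\<^sub>i\<^sup>2/2) \<longlonglongrightarrow> 0\<close>. The integrands are nonnegative
  and, for \<open>t\<close> a suitable multiple of \<open>1/\<eta>\<close>, dominate a multiple of \<open>U\<^sub>i\<^sup>2\<close> where \<open>\<bar>U\<^sub>i\<bar> > \<eta>\<close>, which is
  the Lindeberg condition.
\<close>

section \<open>Estimates for characteristic functions\<close>

context prob_space
begin

lemma char_distr_eq: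
  assumes [measurable]: "random_variable borel U"
  shows "char (distr M borel U) t = (CLINT x|M. iexp (t * U x))"
  by (simp add: char_def integral_distr)

lemma cmod_char_distr_le_1:
  assumes "random_variable borel U"
  shows "cmod (char (distr M borel U) t) \<le> 1"
  using real_distribution.cmod_char_le_1[OF real_distribution_distr[OF assms]] .

lemma integrable_iexp:
  assumes [measurable]: "random_variable borel U"
  shows "integrable M (\<lambda>x. iexp (t * U x))"
  by (rule integrable_const_bound[where B = 1]) auto

lemma cmod_char_minus_one_le_tail:
  assumes [measurable]: "random_variable borel U" and "\<eta> \<ge> 0"
  shows "cmod (char (distr M borel U) t - 1) \<le>
    \<bar>t\<bar> * \<eta> + 2 * prob {x \<in> space M. \<eta> \<le> \<bar>U x\<bar>}"
proof -
  let ?T = "{x \<in> space M. \<eta> \<le> \<bar>U x\<bar>}"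
  have pt: "cmod (iexp (t * U x) - 1) \<le> \<bar>t\<bar> * \<eta> + 2 * indicator ?T x" if "x \<in> space M" for x
  proof (cases "\<eta> \<le> \<bar>U x\<bar>")
    case True
    have "cmod (iexp (t * U x) - 1) \<le> 2"
      using norm_triangle_ineq4[of "iexp (t * U x)" 1] by simp
    then show ?thesis using True that \<open>\<eta> \<ge> 0\<close> by (simp add: add_increasing)
  next
    case False
    have "cmod (iexp (t * U x) - 1) \<le> \<bar>t * U x\<bar>"
      using iexp_approx1[of "t * U x" 0] by simp
    also have "\<dots> \<le> \<bar>t\<bar> * \<eta>"
      using False by (auto simp: abs_mult intro!: mult_left_mono)
    finally show ?thesis using False by simp
  qed
  have "char (distr M borel U) t - 1 = (CLINT x|M. iexp (t * U x) - 1)"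
    unfolding char_distr_eq[OF assms(1)]
    by (subst Bochner_Integration.integral_diff[OF integrable_iexp]) (auto simp: prob_space)
  also have "cmod \<dots> \<le> (\<integral>x. cmod (iexp (t * U x) - 1) \<partial>M)"
    by (rule integral_norm_bound)
  also have "\<dots> \<le> (\<integral>x. \<bar>t\<bar> * \<eta> + 2 * indicator ?T x \<partial>M)"
  proof (rule integral_mono)
    show "integrable M (\<lambda>x. cmod (iexp (t * U x) - 1))"
      by (intro integrable_norm Bochner_Integration.integrable_diff integrable_iexp) auto
  qed (use pt in \<open>auto simp: less_top[symmetric]\<close>)
  also have "\<dots> = \<bar>t\<bar> * \<eta> + 2 * prob ?T"
    by (subst Bochner_Integration.integral_add) (auto simp: prob_space less_top[symmetric])
  finally show ?thesis .
qed

text \<open>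
  The remainder of the second-order expansion of \<open>e\<^sup>i\<^sup>t\<^sup>u\<close> is bounded by the minimum of \<open>t\<^sup>2u\<^sup>2\<close> and
  \<open>\<bar>tu\<bar>\<^sup>3/6\<close>. The first bound is used where \<open>\<bar>U\<bar> > \<eta>\<close>, and elsewhere one factor \<open>\<bar>U\<bar>\<close> of the second
  is replaced by \<open>\<eta>\<close>.
\<close>

lemma cmod_char_second_order_le_tail:
  assumes [measurable]: "random_variable borel U"
    and sq: "integrable M (\<lambda>x. (U x)\<^sup>2)" and mean: "expectation U = 0" and "\<eta> \<ge> 0"
  shows "cmod (char (distr M borel U) t - (1 - t\<^sup>2 / 2 * expectation (\<lambda>x. (U x)\<^sup>2))) \<le>
    t\<^sup>2 * expectation (\<lambda>x. (U x)\<^sup>2 * indicator {x. \<eta> < \<bar>U x\<bar>} x)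
      + \<bar>t\<bar> ^ 3 * \<eta> * expectation (\<lambda>x. (U x)\<^sup>2)"
proof -
  have int: "integrable M U"
    using sq by (rule square_integrable_imp_integrable[rotated]) simp
  have ind: "integrable M (\<lambda>x. (U x)\<^sup>2 * indicator {x. \<eta> < \<bar>U x\<bar>} x)"
    by (rule Bochner_Integration.integrable_bound[OF sq]) (auto simp: indicator_def)
  have "cmod (char (distr M borel U) t - (1 - t\<^sup>2 * expectation (\<lambda>x. (U x)\<^sup>2) / 2)) \<le>
      t\<^sup>2 / 6 * expectation (\<lambda>x. min (6 * (U x)\<^sup>2) (\<bar>t\<bar> * \<bar>U x\<bar> ^ 3))"
    using char_approx3'[OF assms(1) int sq mean, of "expectation (\<lambda>x. (U x)\<^sup>2)" "distr M borel U" t]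
    by (simp add: mean)
  also have "\<dots> \<le> t\<^sup>2 / 6 * expectation (\<lambda>x. 6 * ((U x)\<^sup>2 * indicator {x. \<eta> < \<bar>U x\<bar>} x)
      + \<bar>t\<bar> * \<eta> * (U x)\<^sup>2)"
  proof (intro mult_left_mono integral_mono)
    show "integrable M (\<lambda>x. min (6 * (U x)\<^sup>2) (\<bar>t\<bar> * \<bar>U x\<bar> ^ 3))"
      by (rule Bochner_Integration.integrable_bound[OF integrable_mult_right[OF sq, of 6]]) auto
    show "integrable M (\<lambda>x. 6 * ((U x)\<^sup>2 * indicator {x. \<eta> < \<bar>U x\<bar>} x) + \<bar>t\<bar> * \<eta> * (U x)\<^sup>2)"
      using sq ind by auto
    fix x assume "x \<in> space M"
    show "min (6 * (U x)\<^sup>2) (\<bar>t\<bar> * \<bar>U x\<bar> ^ 3)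
        \<le> 6 * ((U x)\<^sup>2 * indicator {x. \<eta> < \<bar>U x\<bar>} x) + \<bar>t\<bar> * \<eta> * (U x)\<^sup>2"
    proof (cases "\<eta> < \<bar>U x\<bar>")
      case True
      then show ?thesis using \<open>\<eta> \<ge> 0\<close> by (auto intro!: min.coboundedI1)
    next
      case False
      have "\<bar>t\<bar> * \<bar>U x\<bar> ^ 3 = \<bar>t\<bar> * \<bar>U x\<bar> * (U x)\<^sup>2"
        by (simp add: power3_eq_cube power2_eq_square abs_mult_self_eq)
      also have "\<dots> \<le> \<bar>t\<bar> * \<eta> * (U x)\<^sup>2"
        using False by (intro mult_right_mono mult_left_mono) auto
      finally show ?thesis using False by (auto intro!: min.coboundedI2)
    qed
  qed auto
  also have "\<dots> = t\<^sup>2 * expectation (\<lambda>x. (U x)\<^sup>2 * indicator {x. \<eta> < \<bar>U x\<bar>} x)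
      + t\<^sup>2 * \<bar>t\<bar> * \<eta> * expectation (\<lambda>x. (U x)\<^sup>2) / 6"
    using sq ind by (subst Bochner_Integration.integral_add) (auto simp: algebra_simps)
  also have "\<dots> \<le> t\<^sup>2 * expectation (\<lambda>x. (U x)\<^sup>2 * indicator {x. \<eta> < \<bar>U x\<bar>} x)
      + \<bar>t\<bar> ^ 3 * \<eta> * expectation (\<lambda>x. (U x)\<^sup>2)"
  proof -
    have "t\<^sup>2 * \<bar>t\<bar> * \<eta> * expectation (\<lambda>x. (U x)\<^sup>2) = \<bar>t\<bar> ^ 3 * \<eta> * expectation (\<lambda>x. (U x)\<^sup>2)"
      by (simp add: power3_eq_cube power2_eq_square)
    moreover have "0 \<le> \<bar>t\<bar> ^ 3 * \<eta> * expectation (\<lambda>x. (U x)\<^sup>2)"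
      using \<open>\<eta> \<ge> 0\<close> by simp
    ultimately show ?thesis by linarith
  qed
  finally show ?thesis by (simp add: mult.commute)
qed

lemma cmod_char_minus_one_le_second_moment:
  assumes [measurable]: "random_variable borel U"
    and sq: "integrable M (\<lambda>x. (U x)\<^sup>2)" and mean: "expectation U = 0"
  shows "cmod (char (distr M borel U) t - 1) \<le> 2 * t\<^sup>2 * expectation (\<lambda>x. (U x)\<^sup>2)"
proof -
  let ?v = "expectation (\<lambda>x. (U x)\<^sup>2)"
  have "cmod (char (distr M borel U) t - (1 - t\<^sup>2 / 2 * ?v)) \<le>
      t\<^sup>2 * expectation (\<lambda>x. (U x)\<^sup>2 * indicator {x. 0 < \<bar>U x\<bar>} x)"
    using cmod_char_second_order_le_tail[OF assms, of 0 t] by simp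
  also have "expectation (\<lambda>x. (U x)\<^sup>2 * indicator {x. 0 < \<bar>U x\<bar>} x) = ?v"
    by (rule Bochner_Integration.integral_cong) (auto simp: indicator_def)
  finally have *: "cmod (char (distr M borel U) t - (1 - t\<^sup>2 / 2 * ?v)) \<le> t\<^sup>2 * ?v" .
  have "cmod (char (distr M borel U) t - 1) \<le>
      cmod (char (distr M borel U) t - (1 - t\<^sup>2 / 2 * ?v)) + cmod (complex_of_real (t\<^sup>2 / 2 * ?v))"
    by (rule order_trans[OF _ norm_triangle_ineq4]) simp
  also have "cmod (complex_of_real (t\<^sup>2 / 2 * ?v)) = t\<^sup>2 / 2 * ?v"
    by (subst norm_of_real) simp
  finally have "cmod (char (distr M borel U) t - 1) \<le> t\<^sup>2 * ?v + t\<^sup>2 / 2 * ?v"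
    using * by linarith
  also have "\<dots> \<le> 2 * t\<^sup>2 * ?v"
    by simp
  finally show ?thesis .
qed

text \<open>
  Feller's device for recovering the tail from the characteristic function:
  \<open>cos (t u) - 1 + t\<^sup>2u\<^sup>2/2\<close> is nonnegative everywhere, and for \<open>\<bar>u\<bar> > \<eta>\<close> it is at least
  \<open>t\<^sup>2u\<^sup>2/2 - 2 \<ge> (t\<^sup>2/2 - 2/\<eta>\<^sup>2) u\<^sup>2\<close>. Any \<open>t > 2/\<eta>\<close> makes this coefficient positive; with \<open>t = 3/\<eta>\<close>
  it is \<open>5/(2\<eta>\<^sup>2)\<close>.
\<close>

lemma tail_second_moment_le_Re_char:
  assumes [measurable]: "random_variable borel U"
    and sq: "integrable M (\<lambda>x. (U x)\<^sup>2)" and "\<eta> > 0"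
  shows "expectation (\<lambda>x. (U x)\<^sup>2 * indicator {x. \<eta> < \<bar>U x\<bar>} x) \<le>
    2 * \<eta>\<^sup>2 / 5 * (Re (char (distr M borel U) (3 / \<eta>) - 1)
      + (3 / \<eta>)\<^sup>2 / 2 * expectation (\<lambda>x. (U x)\<^sup>2))"
proof -
  define t where "t = 3 / \<eta>"
  have ind: "integrable M (\<lambda>x. (U x)\<^sup>2 * indicator {x. \<eta> < \<bar>U x\<bar>} x)"
    by (rule Bochner_Integration.integrable_bound[OF sq]) (auto simp: indicator_def)
  have cos: "integrable M (\<lambda>x. cos (t * U x))"
    by (rule integrable_const_bound[where B = 1]) auto
  have "5 / (2 * \<eta>\<^sup>2) * expectation (\<lambda>x. (U x)\<^sup>2 * indicator {x. \<eta> < \<bar>U x\<bar>} x) =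
      expectation (\<lambda>x. 5 / (2 * \<eta>\<^sup>2) * ((U x)\<^sup>2 * indicator {x. \<eta> < \<bar>U x\<bar>} x))"
    by simp
  also have "\<dots> \<le> expectation (\<lambda>x. cos (t * U x) - 1 + t\<^sup>2 / 2 * (U x)\<^sup>2)"
  proof (intro integral_mono)
    show "integrable M (\<lambda>x. cos (t * U x) - 1 + t\<^sup>2 / 2 * (U x)\<^sup>2)"
      using cos sq by auto
    show "integrable M (\<lambda>x. 5 / (2 * \<eta>\<^sup>2) * ((U x)\<^sup>2 * indicator {x. \<eta> < \<bar>U x\<bar>} x))"
      using ind by auto
    fix x assume "x \<in> space M"
    show "5 / (2 * \<eta>\<^sup>2) * ((U x)\<^sup>2 * indicator {x. \<eta> < \<bar>U x\<bar>} x) \<le>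
        cos (t * U x) - 1 + t\<^sup>2 / 2 * (U x)\<^sup>2"
    proof (cases "\<eta> < \<bar>U x\<bar>")
      case True
      have "\<eta>\<^sup>2 \<le> (U x)\<^sup>2"
        using True \<open>\<eta> > 0\<close> by (metis abs_le_square_iff abs_of_pos less_imp_le)
      then have "2 \<le> 2 / \<eta>\<^sup>2 * (U x)\<^sup>2"
        using \<open>\<eta> > 0\<close> by (simp add: field_simps)
      moreover have "t\<^sup>2 / 2 * (U x)\<^sup>2 = 5 / (2 * \<eta>\<^sup>2) * (U x)\<^sup>2 + 2 / \<eta>\<^sup>2 * (U x)\<^sup>2"
        using \<open>\<eta> > 0\<close> by (simp add: t_def field_simps)
      moreover have "- 1 \<le> cos (t * U x)" by simp
      ultimately have "5 / (2 * \<eta>\<^sup>2) * (U x)\<^sup>2 \<le> cos (t * U x) - 1 + t\<^sup>2 / 2 * (U x)\<^sup>2"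
        by linarith
      then show ?thesis using True by simp
    next
      case False
      have "1 - cos (t * U x) = 2 * (sin (t * U x / 2))\<^sup>2"
        using cos_double_sin[of "t * U x / 2"] by simp
      also have "\<dots> \<le> 2 * (t * U x / 2)\<^sup>2"
        using abs_sin_x_le_abs_x[of "t * U x / 2"]
        by (intro mult_left_mono) (auto simp only: abs_le_square_iff)
      finally have "1 - cos (t * U x) \<le> t\<^sup>2 / 2 * (U x)\<^sup>2"
        by (simp add: power_mult_distrib power_divide)
      then show ?thesis using False by simp
    qed
  qed
  also have "\<dots> = expectation (\<lambda>x. cos (t * U x)) - 1 + t\<^sup>2 / 2 * expectation (\<lambda>x. (U x)\<^sup>2)"
    using cos sq by (simp add: prob_space)
  also have "expectation (\<lambda>x. cos (t * U x)) = Re (char (distr M borel U) t)"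
    unfolding char_distr_eq[OF assms(1)]
    by (subst integral_Re[symmetric, OF integrable_iexp]) (auto simp: Re_exp)
  finally have "2 * \<eta>\<^sup>2 / 5 * (5 / (2 * \<eta>\<^sup>2) * expectation (\<lambda>x. (U x)\<^sup>2 * indicator {x. \<eta> < \<bar>U x\<bar>} x)) \<le>
      2 * \<eta>\<^sup>2 / 5 * (Re (char (distr M borel U) t) - 1 + t\<^sup>2 / 2 * expectation (\<lambda>x. (U x)\<^sup>2))"
    by (intro mult_left_mono) auto
  then show ?thesis
    using \<open>\<eta> > 0\<close> unfolding t_def by simp
qed

text \<open>
  Only closeness in mean to an independent family matters here: replacing \<open>U\<close> by \<open>V\<close> costs
  \<open>\<bar>t\<bar> E \<bar>U - V\<bar>\<close> per term, once in the sum and once in the product (where the other factors have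
  modulus at most \<open>1\<close>), and for \<open>V\<close> the two sides agree.
\<close>

lemma char_sum_near_prod_of_indep:
  assumes fin: "finite I"
    and U [measurable]: "\<And>i. i \<in> I \<Longrightarrow> random_variable borel (U i)"
    and V: "indep_vars (\<lambda>_. borel) V I"
    and int: "\<And>i. i \<in> I \<Longrightarrow> integrable M (\<lambda>x. U i x - V i x)"
  shows "cmod (char (distr M borel (\<lambda>x. \<Sum>i\<in>I. U i x)) t - (\<Prod>i\<in>I. char (distr M borel (U i)) t))
    \<le> 2 * \<bar>t\<bar> * (\<Sum>i\<in>I. expectation (\<lambda>x. \<bar>U i x - V i x\<bar>))"
proof -
  have V' [measurable]: "random_variable borel (V i)" if "i \<in> I" for i
    using V that by (auto simp: indep_vars_def2)
  have lip: "cmod (char (distr M borel f) t - char (distr M borel g) t)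
      \<le> \<bar>t\<bar> * expectation (\<lambda>x. \<bar>f x - g x\<bar>)"
    if [measurable]: "random_variable borel f" "random_variable borel g"
      and int: "integrable M (\<lambda>x. f x - g x)" for f g
  proof -
    have "char (distr M borel f) t - char (distr M borel g) t =
        (CLINT x|M. iexp (t * f x) - iexp (t * g x))"
      unfolding char_distr_eq[OF that(1)] char_distr_eq[OF that(2)]
      by (subst Bochner_Integration.integral_diff[OF integrable_iexp integrable_iexp]) auto
    also have "cmod \<dots> \<le> (\<integral>x. cmod (iexp (t * f x) - iexp (t * g x)) \<partial>M)"
      by (rule integral_norm_bound)
    also have "\<dots> \<le> (\<integral>x. \<bar>t\<bar> * \<bar>f x - g x\<bar> \<partial>M)"
    proof (rule integral_mono)
      show "integrable M (\<lambda>x. cmod (iexp (t * f x) - iexp (t * g x)))"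
        by (intro integrable_norm Bochner_Integration.integrable_diff integrable_iexp that)
      show "integrable M (\<lambda>x. \<bar>t\<bar> * \<bar>f x - g x\<bar>)"
        using int by simp
      fix x
      have "iexp (t * f x) - iexp (t * g x) = iexp (t * g x) * (iexp (t * (f x - g x)) - 1)"
        by (simp add: algebra_simps flip: exp_add)
      then have "cmod (iexp (t * f x) - iexp (t * g x)) = cmod (iexp (t * (f x - g x)) - 1)"
        by (simp add: norm_mult)
      also have "\<dots> \<le> \<bar>t * (f x - g x)\<bar>"
        using iexp_approx1[of "t * (f x - g x)" 0] by simp
      finally show "cmod (iexp (t * f x) - iexp (t * g x)) \<le> \<bar>t\<bar> * \<bar>f x - g x\<bar>"
        by (simp add: abs_mult)
    qed
    finally show ?thesis by simp
  qed
  define S where "S = (\<Sum>i\<in>I. expectation (\<lambda>x. \<bar>U i x - V i x\<bar>))"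
  have "cmod (char (distr M borel (\<lambda>x. \<Sum>i\<in>I. U i x)) t - char (distr M borel (\<lambda>x. \<Sum>i\<in>I. V i x)) t)
      \<le> \<bar>t\<bar> * expectation (\<lambda>x. \<bar>(\<Sum>i\<in>I. U i x) - (\<Sum>i\<in>I. V i x)\<bar>)"
    using int by (intro lip) (auto simp flip: sum_subtractf)
  also have "\<dots> \<le> \<bar>t\<bar> * expectation (\<lambda>x. \<Sum>i\<in>I. \<bar>U i x - V i x\<bar>)"
    using int by (intro mult_left_mono integral_mono) (auto simp flip: sum_subtractf)
  also have "\<dots> = \<bar>t\<bar> * S"
    using int by (simp add: S_def)
  finally have 1: "cmod (char (distr M borel (\<lambda>x. \<Sum>i\<in>I. U i x)) t
      - char (distr M borel (\<lambda>x. \<Sum>i\<in>I. V i x)) t) \<le> \<bar>t\<bar> * S" .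
  have "cmod ((\<Prod>i\<in>I. char (distr M borel (V i)) t) - (\<Prod>i\<in>I. char (distr M borel (U i)) t))
      \<le> (\<Sum>i\<in>I. cmod (char (distr M borel (V i)) t - char (distr M borel (U i)) t))"
    by (intro norm_prod_diff cmod_char_distr_le_1) auto
  also have "\<dots> \<le> (\<Sum>i\<in>I. \<bar>t\<bar> * expectation (\<lambda>x. \<bar>U i x - V i x\<bar>))"
    using int by (intro sum_mono) (subst norm_minus_commute, auto intro!: lip)
  also have "\<dots> = \<bar>t\<bar> * S"
    by (simp add: S_def sum_distrib_left)
  finally have "cmod (char (distr M borel (\<lambda>x. \<Sum>i\<in>I. V i x)) t
      - (\<Prod>i\<in>I. char (distr M borel (U i)) t)) \<le> \<bar>t\<bar> * S"
    by (simp add: char_distr_sum[OF V])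
  with 1 show ?thesis
    unfolding S_def[symmetric]
    using norm_triangle_mono[OF 1] by (fastforce simp: algebra_simps)
qed

end

text \<open>
  The product is compared factor by factor with that of the \<open>exp (z\<^sub>i - 1)\<close>, which also lie in the
  closed unit disc since \<open>Re z\<^sub>i \<le> 1\<close>. Each factor contributes an error quadratic in \<open>z\<^sub>i - 1\<close>, so a
  uniform bound on the \<open>\<bar>z\<^sub>i - 1\<bar>\<close> and a bound on their sum make the total error small.
\<close>

lemma cmod_prod_minus_exp_sum_le:
  fixes z :: "'i \<Rightarrow> complex"
  assumes "\<And>i. i \<in> I \<Longrightarrow> cmod (z i) \<le> 1" and "\<And>i. i \<in> I \<Longrightarrow> cmod (z i - 1) \<le> \<delta>"
  shows "cmod ((\<Prod>i\<in>I. z i) - exp (\<Sum>i\<in>I. z i - 1)) \<le> exp 2 * \<delta> * (\<Sum>i\<in>I. cmod (z i - 1))"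
proof (cases "finite I")
  case True
  have Re: "Re (z i - 1) \<le> 0" "\<bar>Re (z i - 1)\<bar> \<le> 2" if "i \<in> I" for i
    using abs_Re_le_cmod[of "z i"] assms(1)[OF that] by auto
  have "cmod ((\<Prod>i\<in>I. z i) - (\<Prod>i\<in>I. exp (z i - 1))) \<le> (\<Sum>i\<in>I. cmod (z i - exp (z i - 1)))"
    using assms(1) Re by (intro norm_prod_diff) auto
  also have "\<dots> \<le> (\<Sum>i\<in>I. exp 2 * \<delta> * cmod (z i - 1))"
  proof (intro sum_mono)
    fix i assume i: "i \<in> I"
    have "cmod (z i - exp (z i - 1)) = cmod (exp (z i - 1) - (\<Sum>k\<le>1. (z i - 1) ^ k / fact k))"
      by (subst norm_minus_commute) simp
    also have "\<dots> \<le> exp \<bar>Re (z i - 1)\<bar> * cmod (z i - 1) ^ Suc 1 / fact 1"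
      by (rule Taylor_exp)
    also have "\<dots> = exp \<bar>Re (z i - 1)\<bar> * cmod (z i - 1) * cmod (z i - 1)"
      by simp
    also have "\<dots> \<le> exp 2 * \<delta> * cmod (z i - 1)"
      using Re[OF i] assms(2)[OF i] by (intro mult_right_mono mult_mono) auto
    finally show "cmod (z i - exp (z i - 1)) \<le> exp 2 * \<delta> * cmod (z i - 1)" .
  qed
  finally show ?thesis
    using True by (simp add: exp_sum sum_distrib_left)
qed simp

section \<open>Lindeberg--Feller for asymptotically independent arrays\<close>

text \<open>
  Truncation at level \<open>\<eta>\<close> produces an error of order \<open>\<eta>\<close> and a term that vanishes in the limit for
  every fixed \<open>\<eta>\<close>; the level is then sent to \<open>0\<close> last.
\<close>

lemma tendsto_zero_if_norm_le:
  fixes f :: "nat \<Rightarrow> 'b::real_normed_vector"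
  assumes "\<And>\<eta>. \<eta> > 0 \<Longrightarrow> g \<eta> \<longlonglongrightarrow> 0"
    and "\<And>\<eta> l. \<eta> > 0 \<Longrightarrow> norm (f l) \<le> C * \<eta> + g \<eta> l"
  shows "f \<longlonglongrightarrow> 0"
proof (rule tendstoI)
  fix e :: real assume "e > 0"
  define \<eta> where "\<eta> = e / (2 * (\<bar>C\<bar> + 1))"
  have "\<eta> > 0" using \<open>e > 0\<close> by (simp add: \<eta>_def)
  have "C * \<eta> \<le> (\<bar>C\<bar> + 1) * \<eta>"
    using \<open>\<eta> > 0\<close> by (intro mult_right_mono) auto
  also have "\<dots> = e / 2"
    by (simp add: \<eta>_def field_simps)
  finally have "C * \<eta> \<le> e / 2" .
  moreover have "eventually (\<lambda>l. dist (g \<eta> l) 0 < e / 2) sequentially"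
    using tendstoD[OF assms(1)[OF \<open>\<eta> > 0\<close>], of "e / 2"] \<open>e > 0\<close> by simp
  ultimately show "eventually (\<lambda>l. dist (f l) 0 < e) sequentially"
    using assms(2)[OF \<open>\<eta> > 0\<close>]
    by (elim eventually_mono) (smt (verit) dist_norm diff_zero real_norm_def field_sum_of_halves)
qed

text \<open>
  Independence of the entries in a row is relaxed to the asymptotic factorisation of the
  characteristic function of the row sum.
\<close>

locale asymptotically_independent_array =
  fixes M :: "nat \<Rightarrow> 'a measure" and I :: "nat \<Rightarrow> 'i set" and U :: "nat \<Rightarrow> 'i \<Rightarrow> 'a \<Rightarrow> real"
  assumes prob_space_M: "prob_space (M l)"
    and fin: "finite (I l)" and ne: "I l \<noteq> {}"
    and meas: "i \<in> I l \<Longrightarrow> U l i \<in> borel_measurable (M l)"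
    and sq: "i \<in> I l \<Longrightarrow> integrable (M l) (\<lambda>x. (U l i x)\<^sup>2)"
    and mean: "i \<in> I l \<Longrightarrow> (\<integral>x. U l i x \<partial>M l) = 0"
    and total_variance: "(\<Sum>i\<in>I l. \<integral>x. (U l i x)\<^sup>2 \<partial>M l) = 1"
    and char_sum_minus_prod: "(\<lambda>l. char (distr (M l) borel (\<lambda>x. \<Sum>i\<in>I l. U l i x)) t
      - (\<Prod>i\<in>I l. char (distr (M l) borel (U l i)) t)) \<longlonglongrightarrow> 0"
begin

definition lindeberg :: bool where
  "lindeberg \<longleftrightarrow> (\<forall>\<eta>>0.
     (\<lambda>l. \<Sum>i\<in>I l. \<integral>x. (U l i x)\<^sup>2 * indicator {x. \<eta> < \<bar>U l i x\<bar>} x \<partial>M l) \<longlonglongrightarrow> 0)"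

definition negligible_terms :: bool where
  "negligible_terms \<longleftrightarrow> (\<forall>\<eta>>0.
     (\<lambda>l. MAX i\<in>I l. measure (M l) {x \<in> space (M l). \<eta> \<le> \<bar>U l i x\<bar>}) \<longlonglongrightarrow> 0)"

definition normal_limit :: bool where
  "normal_limit \<longleftrightarrow> (\<forall>t. (\<lambda>l. measure (M l) {x \<in> space (M l). (\<Sum>i\<in>I l. U l i x) \<le> t})
     \<longlonglongrightarrow> cdf std_normal_distribution t)"

abbreviation \<phi> :: "nat \<Rightarrow> 'i \<Rightarrow> real \<Rightarrow> complex" where
  "\<phi> l i \<equiv> char (distr (M l) borel (U l i))"

text \<open>
  Levy's continuity theorem, applied to the row sums; the normal distribution function has no jumps,
  so weak convergence is convergence at every point.
\<close>

lemma normal_limit_iff_char_prod: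
  "normal_limit \<longleftrightarrow> (\<forall>t. (\<lambda>l. \<Prod>i\<in>I l. \<phi> l i t) \<longlonglongrightarrow> complex_of_real (exp (- (t\<^sup>2) / 2)))"
proof -
  define D where "D l = distr (M l) borel (\<lambda>x. \<Sum>i\<in>I l. U l i x)" for l
  have S [measurable]: "(\<lambda>x. \<Sum>i\<in>I l. U l i x) \<in> borel_measurable (M l)" for l
    using meas by auto
  have D: "real_distribution (D l)" for l
    unfolding D_def by (rule prob_space.real_distribution_distr[OF prob_space_M S])
  have "measure std_normal_distribution {x} = 0" for x
    by (simp add: measure_def emeasure_density nn_integral_null_set)
  then have cont: "isCont (cdf std_normal_distribution) x" for x
    using finite_borel_measure.isCont_cdf real_dist_normal_dist
      real_distribution.finite_borel_measure_M by blast
  have cdf: "cdf (D l) t = measure (M l) {x \<in> space (M l). (\<Sum>i\<in>I l. U l i x) \<le> t}" for l t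
    by (auto simp: cdf_def D_def measure_distr intro!: arg_cong[where f = "measure (M l)"])
  have "normal_limit \<longleftrightarrow> weak_conv_m D std_normal_distribution"
    using cont by (simp add: normal_limit_def weak_conv_m_def weak_conv_def cdf)
  also have "\<dots> \<longleftrightarrow> (\<forall>t. (\<lambda>l. char (D l) t) \<longlonglongrightarrow> char std_normal_distribution t)"
    using levy_continuity[of D, OF D real_dist_normal_dist]
      levy_continuity1[of D, OF D real_dist_normal_dist] by blast
  also have "\<dots> \<longleftrightarrow> (\<forall>t. (\<lambda>l. \<Prod>i\<in>I l. \<phi> l i t) \<longlonglongrightarrow> char std_normal_distribution t)"
    using char_sum_minus_prod unfolding D_def
    by (auto intro: Lim_transform Lim_transform2)
  finally show ?thesis
    by (simp add: char_std_normal_distribution)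
qed

lemma sum_cmod_char_minus_one_le: "(\<Sum>i\<in>I l. cmod (\<phi> l i t - 1)) \<le> 2 * t\<^sup>2"
proof -
  have "(\<Sum>i\<in>I l. cmod (\<phi> l i t - 1)) \<le> (\<Sum>i\<in>I l. 2 * t\<^sup>2 * (\<integral>x. (U l i x)\<^sup>2 \<partial>M l))"
    by (intro sum_mono prob_space.cmod_char_minus_one_le_second_moment[OF prob_space_M] meas sq mean)
  then show ?thesis
    using total_variance[of l] by (simp flip: sum_distrib_left)
qed

text \<open>
  The accompanying law: \<open>exp (\<phi> - 1)\<close> is the characteristic function of a compound Poisson
  distribution, and negligible terms may be replaced by these.
\<close>

lemma prod_char_minus_exp_sum:
  assumes negligible_terms
  shows "(\<lambda>l. (\<Prod>i\<in>I l. \<phi> l i t) - exp (\<Sum>i\<in>I l. \<phi> l i t - 1)) \<longlonglongrightarrow> 0"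
proof (rule tendsto_zero_if_norm_le)
  define m where "m \<eta> l = (MAX i\<in>I l. measure (M l) {x \<in> space (M l). \<eta> \<le> \<bar>U l i x\<bar>})" for \<eta> l
  fix \<eta> :: real assume "\<eta> > 0"
  show "(\<lambda>l. exp 2 * 2 * t\<^sup>2 * 2 * m \<eta> l) \<longlonglongrightarrow> 0"
    using assms \<open>\<eta> > 0\<close> by (auto simp: negligible_terms_def m_def intro!: tendsto_mult_right_zero)
  fix l
  have le: "measure (M l) {x \<in> space (M l). \<eta> \<le> \<bar>U l i x\<bar>} \<le> m \<eta> l" if "i \<in> I l" for i
    using fin that unfolding m_def by (intro Max_ge) auto
  obtain i where "i \<in> I l" using ne by blast
  then have "0 \<le> m \<eta> l"
    using le measure_nonneg order_trans by blast
  have "cmod ((\<Prod>i\<in>I l. \<phi> l i t) - exp (\<Sum>i\<in>I l. \<phi> l i t - 1)) \<le>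
      exp 2 * (\<bar>t\<bar> * \<eta> + 2 * m \<eta> l) * (\<Sum>i\<in>I l. cmod (\<phi> l i t - 1))"
  proof (rule cmod_prod_minus_exp_sum_le)
    fix i assume i: "i \<in> I l"
    show "cmod (\<phi> l i t) \<le> 1"
      by (rule prob_space.cmod_char_distr_le_1[OF prob_space_M meas[OF i]])
    show "cmod (\<phi> l i t - 1) \<le> \<bar>t\<bar> * \<eta> + 2 * m \<eta> l"
      using prob_space.cmod_char_minus_one_le_tail[OF prob_space_M meas[OF i], of \<eta> t]
        le[OF i] \<open>\<eta> > 0\<close> by linarith
  qed
  also have "\<dots> \<le> exp 2 * (\<bar>t\<bar> * \<eta> + 2 * m \<eta> l) * (2 * t\<^sup>2)"
    using \<open>0 \<le> m \<eta> l\<close> \<open>\<eta> > 0\<close> by (intro mult_left_mono sum_cmod_char_minus_one_le) auto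
  finally show "cmod ((\<Prod>i\<in>I l. \<phi> l i t) - exp (\<Sum>i\<in>I l. \<phi> l i t - 1)) \<le>
      exp 2 * 2 * t\<^sup>2 * \<bar>t\<bar> * \<eta> + exp 2 * 2 * t\<^sup>2 * 2 * m \<eta> l"
    by (simp add: algebra_simps)
qed

text \<open>
  Chebyshev's inequality, truncated. Negligibility concerns \<open>\<bar>U\<bar> \<ge> \<eta>\<close> but the Lindeberg sums concern
  the strict inequality, so the Lindeberg condition is used at level \<open>\<eta>/2\<close>.
\<close>

lemma lindeberg_imp_negligible_terms:
  assumes lindeberg
  shows negligible_terms
  unfolding negligible_terms_def
proof (intro allI impI)
  fix \<eta> :: real assume "\<eta> > 0"
  define L where "L l i = (\<integral>x. (U l i x)\<^sup>2 * indicator {x. \<eta> / 2 < \<bar>U l i x\<bar>} x \<partial>M l)" for l i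
  have "(\<lambda>l. \<Sum>i\<in>I l. L l i) \<longlonglongrightarrow> 0"
    using assms[unfolded lindeberg_def, rule_format, of "\<eta> / 2"] \<open>\<eta> > 0\<close> by (simp add: L_def)
  then have lim: "(\<lambda>l. 1 / \<eta>\<^sup>2 * (\<Sum>i\<in>I l. L l i)) \<longlonglongrightarrow> 0"
    by (rule tendsto_mult_right_zero)
  have "0 \<le> L l i" for l i
    unfolding L_def by (rule Bochner_Integration.integral_nonneg) auto
  have le: "measure (M l) {x \<in> space (M l). \<eta> \<le> \<bar>U l i x\<bar>} \<le> 1 / \<eta>\<^sup>2 * (\<Sum>i\<in>I l. L l i)"
    if i: "i \<in> I l" for l i
  proof -
    interpret prob_space "M l" by (rule prob_space_M)
    note [measurable] = meas[OF i]
    have ind: "integrable (M l) (\<lambda>x. (U l i x)\<^sup>2 * indicator {x. \<eta> / 2 < \<bar>U l i x\<bar>} x)"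
      by (rule Bochner_Integration.integrable_bound[OF sq[OF i]]) (auto simp: indicator_def)
    have "prob {x \<in> space (M l). \<eta> \<le> \<bar>U l i x\<bar>}
        = (\<integral>x. indicator {x \<in> space (M l). \<eta> \<le> \<bar>U l i x\<bar>} x \<partial>M l)"
      by simp
    also have "\<dots> \<le> (\<integral>x. 1 / \<eta>\<^sup>2 * ((U l i x)\<^sup>2 * indicator {x. \<eta> / 2 < \<bar>U l i x\<bar>} x) \<partial>M l)"
    proof (rule integral_mono)
      fix x
      show "indicator {x \<in> space (M l). \<eta> \<le> \<bar>U l i x\<bar>} x
          \<le> 1 / \<eta>\<^sup>2 * ((U l i x)\<^sup>2 * indicator {x. \<eta> / 2 < \<bar>U l i x\<bar>} x)"
      proof (cases "\<eta> \<le> \<bar>U l i x\<bar>")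
        case True
        then have "\<eta>\<^sup>2 \<le> (U l i x)\<^sup>2"
          using \<open>\<eta> > 0\<close> by (metis abs_le_square_iff abs_of_pos)
        then show ?thesis
          using True \<open>\<eta> > 0\<close> by (auto simp: indicator_def field_simps)
      qed (auto simp: indicator_def)
    qed (use ind in \<open>auto simp: less_top[symmetric]\<close>)
    also have "\<dots> = 1 / \<eta>\<^sup>2 * L l i"
      by (simp add: L_def)
    also have "\<dots> \<le> 1 / \<eta>\<^sup>2 * (\<Sum>i\<in>I l. L l i)"
      using i fin \<open>\<And>l i. 0 \<le> L l i\<close> by (intro mult_left_mono member_le_sum) auto
    finally show ?thesis .
  qed
  show "(\<lambda>l. MAX i\<in>I l. measure (M l) {x \<in> space (M l). \<eta> \<le> \<bar>U l i x\<bar>}) \<longlonglongrightarrow> 0"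
  proof (rule tendsto_sandwich[OF _ _ tendsto_const lim])
    show "\<forall>\<^sub>F l in sequentially. (MAX i\<in>I l. measure (M l) {x \<in> space (M l). \<eta> \<le> \<bar>U l i x\<bar>})
        \<le> 1 / \<eta>\<^sup>2 * (\<Sum>i\<in>I l. L l i)"
      using le fin ne by (intro always_eventually) auto
    show "\<forall>\<^sub>F l in sequentially. 0 \<le> (MAX i\<in>I l. measure (M l) {x \<in> space (M l). \<eta> \<le> \<bar>U l i x\<bar>})"
      using fin ne by (intro always_eventually) (auto simp: Max_ge_iff ex_in_conv)
  qed
qed

lemma lindeberg_imp_normal_limit:
  assumes lindeberg
  shows normal_limit
  unfolding normal_limit_iff_char_prod
proof
  fix t :: real
  have "(\<lambda>l. (\<Sum>i\<in>I l. \<phi> l i t - 1) - complex_of_real (- (t\<^sup>2) / 2)) \<longlonglongrightarrow> 0"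
  proof (rule tendsto_zero_if_norm_le)
    define L where "L \<eta> l i = (\<integral>x. (U l i x)\<^sup>2 * indicator {x. \<eta> < \<bar>U l i x\<bar>} x \<partial>M l)" for \<eta> l i
    fix \<eta> :: real assume "\<eta> > 0"
    show "(\<lambda>l. t\<^sup>2 * (\<Sum>i\<in>I l. L \<eta> l i)) \<longlonglongrightarrow> 0"
      using assms \<open>\<eta> > 0\<close> unfolding lindeberg_def L_def by (intro tendsto_mult_right_zero) auto
    fix l
    let ?v = "\<lambda>i. \<integral>x. (U l i x)\<^sup>2 \<partial>M l"
    have "complex_of_real (- (t\<^sup>2) / 2) = (\<Sum>i\<in>I l. complex_of_real (- (t\<^sup>2) / 2 * ?v i))"
      unfolding of_real_sum[symmetric] sum_distrib_left[symmetric] total_variance by simp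
    then have "(\<Sum>i\<in>I l. \<phi> l i t - 1) - complex_of_real (- (t\<^sup>2) / 2) =
        (\<Sum>i\<in>I l. \<phi> l i t - complex_of_real (1 - t\<^sup>2 / 2 * ?v i))"
      by (simp add: sum_subtractf sum.distrib sum_negf)
    also have "cmod \<dots> \<le> (\<Sum>i\<in>I l. t\<^sup>2 * L \<eta> l i + \<bar>t\<bar> ^ 3 * \<eta> * ?v i)"
      unfolding L_def using \<open>\<eta> > 0\<close>
      by (intro sum_norm_le prob_space.cmod_char_second_order_le_tail[OF prob_space_M] meas sq mean) auto
    also have "\<dots> = \<bar>t\<bar> ^ 3 * \<eta> + t\<^sup>2 * (\<Sum>i\<in>I l. L \<eta> l i)"
      using total_variance[of l] by (simp add: sum.distrib flip: sum_distrib_left)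
    finally show "cmod ((\<Sum>i\<in>I l. \<phi> l i t - 1) - complex_of_real (- (t\<^sup>2) / 2)) \<le>
        \<bar>t\<bar> ^ 3 * \<eta> + t\<^sup>2 * (\<Sum>i\<in>I l. L \<eta> l i)" .
  qed
  then have "(\<lambda>l. exp (\<Sum>i\<in>I l. \<phi> l i t - 1)) \<longlonglongrightarrow> exp (complex_of_real (- (t\<^sup>2) / 2))"
    by (rule tendsto_exp[OF LIM_zero_cancel])
  then have "(\<lambda>l. exp (\<Sum>i\<in>I l. \<phi> l i t - 1)) \<longlonglongrightarrow> complex_of_real (exp (- (t\<^sup>2) / 2))"
    by (simp only: exp_of_real)
  then show "(\<lambda>l. \<Prod>i\<in>I l. \<phi> l i t) \<longlonglongrightarrow> complex_of_real (exp (- (t\<^sup>2) / 2))"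
    using Lim_transform[OF _ prod_char_minus_exp_sum[OF lindeberg_imp_negligible_terms[OF assms]]]
    by blast
qed

text \<open>
  Comparing moduli avoids a choice of logarithm: \<open>\<bar>exp z\<bar> = exp (Re z)\<close>, and the real part is all
  that the lower bound for the tails needs.
\<close>

lemma negligible_terms_normal_limit_imp_lindeberg:
  assumes negligible_terms normal_limit
  shows lindeberg
  unfolding lindeberg_def
proof (intro allI impI)
  fix \<eta> :: real assume "\<eta> > 0"
  define t where "t = 3 / \<eta>"
  define R where "R l = (\<Sum>i\<in>I l. Re (\<phi> l i t - 1))" for l
  define L where "L l i = (\<integral>x. (U l i x)\<^sup>2 * indicator {x. \<eta> < \<bar>U l i x\<bar>} x \<partial>M l)" for l i
  have "(\<lambda>l. exp (\<Sum>i\<in>I l. \<phi> l i t - 1)) \<longlonglongrightarrow> complex_of_real (exp (- (t\<^sup>2) / 2))"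
    using Lim_transform2[OF _ prod_char_minus_exp_sum[OF assms(1)]] assms(2)
    unfolding normal_limit_iff_char_prod by blast
  then have "(\<lambda>l. cmod (exp (\<Sum>i\<in>I l. \<phi> l i t - 1))) \<longlonglongrightarrow> cmod (complex_of_real (exp (- (t\<^sup>2) / 2)))"
    by (rule tendsto_norm)
  then have "(\<lambda>l. exp (R l)) \<longlonglongrightarrow> exp (- (t\<^sup>2) / 2)"
    by (simp add: R_def norm_of_real)
  then have "(\<lambda>l. ln (exp (R l))) \<longlonglongrightarrow> ln (exp (- (t\<^sup>2) / 2))"
    by (rule tendsto_ln) simp
  then have "R \<longlonglongrightarrow> - (t\<^sup>2) / 2" by simp
  then have "(\<lambda>l. 2 * \<eta>\<^sup>2 / 5 * (R l + t\<^sup>2 / 2)) \<longlonglongrightarrow> 2 * \<eta>\<^sup>2 / 5 * (- (t\<^sup>2) / 2 + t\<^sup>2 / 2)"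
    by (intro tendsto_intros)
  then have lim: "(\<lambda>l. 2 * \<eta>\<^sup>2 / 5 * (R l + t\<^sup>2 / 2)) \<longlonglongrightarrow> 0" by simp
  have "0 \<le> L l i" for l i
    unfolding L_def by (rule Bochner_Integration.integral_nonneg) auto
  moreover have "(\<Sum>i\<in>I l. L l i) \<le> 2 * \<eta>\<^sup>2 / 5 * (R l + t\<^sup>2 / 2)" for l
  proof -
    have "(\<Sum>i\<in>I l. L l i) \<le>
        (\<Sum>i\<in>I l. 2 * \<eta>\<^sup>2 / 5 * (Re (\<phi> l i t - 1) + t\<^sup>2 / 2 * (\<integral>x. (U l i x)\<^sup>2 \<partial>M l)))"
      unfolding L_def t_def
      by (intro sum_mono prob_space.tail_second_moment_le_Re_char[OF prob_space_M] meas sq \<open>\<eta> > 0\<close>)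
    also have "\<dots> = 2 * \<eta>\<^sup>2 / 5 * (R l + t\<^sup>2 / 2)"
      unfolding sum_distrib_left[symmetric] sum.distrib R_def total_variance by simp
    finally show ?thesis .
  qed
  ultimately show "(\<lambda>l. \<Sum>i\<in>I l. L l i) \<longlonglongrightarrow> 0"
    by (intro tendsto_sandwich[OF _ _ tendsto_const lim] always_eventually allI sum_nonneg)
qed

theorem lindeberg_iff: "lindeberg \<longleftrightarrow> negligible_terms \<and> normal_limit"
  using lindeberg_imp_negligible_terms lindeberg_imp_normal_limit
    negligible_terms_normal_limit_imp_lindeberg by blast

end

section \<open>Periodic points shadowing a product\<close>

text \<open>
  Used to transport the independence of the coordinates on a product space to a space that is mapped
  to it.
\<close>

lemma (in prob_space) indep_vars_distrD:
  assumes [measurable]: "f \<in> measurable M N"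
    and indep: "prob_space.indep_vars (distr M N f) M' X I" and "I \<noteq> {}"
  shows "indep_vars M' (\<lambda>i x. X i (f x)) I"
proof -
  interpret D: prob_space "distr M N f" by (rule prob_space_distr) simp
  have X [measurable]: "X i \<in> measurable N (M' i)" if "i \<in> I" for i
    using indep that by (auto simp: D.indep_vars_def2)
  have "distr M (\<Pi>\<^sub>M i\<in>I. M' i) (\<lambda>x. \<lambda>i\<in>I. X i (f x)) =
      distr (distr M N f) (\<Pi>\<^sub>M i\<in>I. M' i) (\<lambda>x. \<lambda>i\<in>I. X i x)"
    by (subst distr_distr) (auto simp: comp_def)
  also have "\<dots> = (\<Pi>\<^sub>M i\<in>I. distr (distr M N f) (M' i) (X i))"
    using indep by (subst D.indep_vars_iff_distr_eq_PiM'[symmetric]) (auto simp: \<open>I \<noteq> {}\<close>)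
  also have "\<dots> = (\<Pi>\<^sub>M i\<in>I. distr M (M' i) (\<lambda>x. X i (f x)))"
    by (intro PiM_cong) (auto simp: distr_distr comp_def)
  finally show ?thesis
    by (subst indep_vars_iff_distr_eq_PiM') (auto simp: \<open>I \<noteq> {}\<close>)
qed

text \<open>
  Through the bijection, the uniform distribution on \<open>Q\<close> becomes the uniform distribution on the
  product, which is the product of the uniform distributions on the factors.
\<close>

lemma indep_vars_coordinates:
  assumes bij: "bij_betw \<Phi> (PiE I E) Q" and "finite Q" "Q \<noteq> {}" "finite I" "I \<noteq> {}"
  shows "prob_space.indep_vars (measure_pmf (pmf_of_set Q)) (\<lambda>_. count_space UNIV)
    (\<lambda>i p. inv_into (PiE I E) \<Phi> p i) I"
proof (rule prob_space.indep_vars_distrD[where X = "\<lambda>i x. x i" and N = "count_space UNIV"])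
  have PiE: "finite (PiE I E)" "PiE I E \<noteq> {}"
    using bij_betw_finite[OF bij] bij_betw_imp_surj_on[OF bij] \<open>finite Q\<close> \<open>Q \<noteq> {}\<close> by auto
  then have ne: "E i \<noteq> {}" if "i \<in> I" for i
    using that by (auto simp: PiE_eq_empty_iff)
  have fin: "finite (E i)" if "i \<in> I" for i
    using PiE that by (metis finite_imageI image_projection_PiE)
  have "map_pmf (inv_into (PiE I E) \<Phi>) (pmf_of_set Q) = pmf_of_set (PiE I E)"
    using assms by (intro map_pmf_of_set_bij_betw[OF bij_betw_inv_into[OF bij]])
  moreover have "PiE_dflt I undefined E = PiE I E"
    by (auto simp: PiE_dflt_def PiE_def extensional_def Pi_def)
  moreover have "Pi_pmf I undefined (\<lambda>i. pmf_of_set (E i)) = pmf_of_set (PiE_dflt I undefined E)"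
    using fin ne \<open>finite I\<close> by (intro Pi_pmf_of_set)
  ultimately have "map_pmf (inv_into (PiE I E) \<Phi>) (pmf_of_set Q) =
      Pi_pmf I undefined (\<lambda>i. pmf_of_set (E i))"
    by simp
  then show "prob_space.indep_vars
      (distr (measure_pmf (pmf_of_set Q)) (count_space UNIV) (inv_into (PiE I E) \<Phi>))
      (\<lambda>_. count_space UNIV) (\<lambda>i x. x i) I"
    unfolding map_pmf_rep_eq[symmetric] by (simp add: indep_vars_Pi_pmf[OF \<open>finite I\<close>])
qed (auto simp: measure_pmf.prob_space_axioms \<open>I \<noteq> {}\<close>)

lemma bowen_ball_commute: "y \<in> bowen_ball T n \<epsilon> x \<longleftrightarrow> x \<in> bowen_ball T n \<epsilon> y"
  by (simp add: bowen_ball_def bowen_dist_def dist_commute)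

text \<open>
  The dynamical input: a uniformly random point of \<open>Q\<close> is shadowed, block by block, by independent
  random periodic points.
\<close>

lemma locally_independent_imp_indep_shadows:
  assumes "locally_independent T \<epsilon> n k A E Q" "finite Q" "Q \<noteq> {}" "k \<ge> 1"
    and "\<And>i. i \<in> {1..k} \<Longrightarrow> E i \<subseteq> Per T"
  obtains x where
    "prob_space.indep_vars (measure_pmf (pmf_of_set Q)) (\<lambda>_. count_space UNIV) x {1..k}"
    "\<And>i p. i \<in> {1..k} \<Longrightarrow> p \<in> Q \<Longrightarrow> x i p \<in> bowen_ball T n \<epsilon> ((T ^^ ((i - 1) * n)) p) \<inter> Per T"
proof -
  obtain \<Phi> where bij: "bij_betw \<Phi> (PiE {1..k} E) Q"
    and ball: "\<forall>x\<in>PiE {1..k} E. \<forall>i\<in>{1..k}.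
      (T ^^ ((i - 1) * n)) (\<Phi> x) \<in> bowen_ball T n \<epsilon> (x i)"
    using assms(1) unfolding locally_independent_def by (elim conjE exE) (rule that)
  show thesis
  proof (rule that)
    show "prob_space.indep_vars (measure_pmf (pmf_of_set Q)) (\<lambda>_. count_space UNIV)
        (\<lambda>i p. inv_into (PiE {1..k} E) \<Phi> p i) {1..k}"
      using assms(2-4) by (intro indep_vars_coordinates[OF bij]) auto
    fix i p assume i: "i \<in> {1..k}" and p: "p \<in> Q"
    let ?x = "inv_into (PiE {1..k} E) \<Phi> p"
    have x: "?x \<in> PiE {1..k} E" "\<Phi> ?x = p"
      using p bij_betw_imp_surj_on[OF bij] by (metis inv_into_into, metis f_inv_into_f)
    show "?x i \<in> bowen_ball T n \<epsilon> ((T ^^ ((i - 1) * n)) p) \<inter> Per T"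
      using ball[rule_format, OF x(1) i] x(2) subsetD[OF assms(5)[OF i] PiE_mem[OF x(1) i]]
      by (subst (asm) bowen_ball_commute) simp
  qed
qed

theorem theoremC:
  fixes T :: "'a::metric_space \<Rightarrow> 'a"
    and \<epsilon> :: "nat \<Rightarrow> real"
    and k n :: "nat \<Rightarrow> nat"
    and \<U> :: "nat \<Rightarrow> 'a set set"
    and A :: "nat \<Rightarrow> 'a set"
    and E :: "nat \<Rightarrow> nat \<Rightarrow> 'a set"
    and Q :: "nat \<Rightarrow> 'a set"
    and h :: "nat \<Rightarrow> nat \<Rightarrow> 'a \<Rightarrow> real"
    and s :: "nat \<Rightarrow> real"
    and Y :: "nat \<Rightarrow> nat \<Rightarrow> 'a \<Rightarrow> real"
  assumes "compact (UNIV :: 'a set)"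
    and "continuous_on UNIV T"
    and "\<And>m. m \<ge> 1 \<Longrightarrow> finite (periodic_pts T m)"
    and "\<And>l. \<epsilon> l > 0"
    and "\<And>l. k l \<ge> 1"
    and "\<And>l. n l \<ge> 1"
    and "\<And>l U. U \<in> \<U> l \<Longrightarrow> open U"
    and "\<And>l. A l \<in> join_family T (n l) (k l) (\<U> l)"
    and "\<And>l. finite (Q l)"
    and "\<And>l. Q l \<noteq> {}"
    and "\<And>l. locally_independent T (\<epsilon> l) (n l) (k l) (A l) (E l) (Q l)"
    and "\<And>l i. i \<in> {1..k l} \<Longrightarrow> E l i \<subseteq> Per T"
    and "Y = (\<lambda>l i. birkhoff_sum T (h l i) ((i - 1) * n l) (n l))"
    and "s = (\<lambda>l. sqrt (\<Sum>i=1..k l. unif_variance (Q l) (Y l i)))"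
    and "\<And>l. s l > 0"
    and "\<And>j. j \<in> {1, 2} \<Longrightarrow>
           (\<lambda>l. (\<Sum>i=1..k l. \<integral>\<^sup>+ p. oscillation T (h l i) (\<epsilon> l) ((i - 1) * n l) (n l) p ^ j
                    \<partial>measure_pmf (pmf_of_set (Q l))) / ennreal (s l ^ j)) \<longlonglongrightarrow> 0"
  shows "(\<forall>\<eta>>0. (\<lambda>l. (\<Sum>i=1..k l. lindeberg_fun (Q l) (Y l i) (\<eta> * s l)) / (s l)\<^sup>2) \<longlonglongrightarrow> 0)
     \<longleftrightarrow>
       (\<forall>\<eta>>0. (\<lambda>l. MAX i\<in>{1..k l}.
            unif_prob (Q l) {p. \<bar>Y l i p - unif_expectation (Q l) (Y l i)\<bar> \<ge> \<eta> * s l}) \<longlonglongrightarrow> 0)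
       \<and>
       (\<forall>t. (\<lambda>l. unif_prob (Q l)
            {p. (\<Sum>i=1..k l. Y l i p - unif_expectation (Q l) (Y l i)) \<le> t * s l})
            \<longlonglongrightarrow> cdf std_normal_distribution t)"
proof -
  note finQ = assms(9) and neQ = assms(10) and Y = assms(13) and s = assms(14) and spos = assms(15)
  let ?q = "\<lambda>l. measure_pmf (pmf_of_set (Q l))"
  have int: "integrable (?q l) f" for l and f :: "'a \<Rightarrow> real"
    by (rule integrable_measure_pmf_finite) (simp add: finQ neQ)
  have "\<forall>l. \<exists>x. prob_space.indep_vars (?q l) (\<lambda>_. count_space UNIV) x {1..k l} \<and>
      (\<forall>i\<in>{1..k l}. \<forall>p\<in>Q l. x i p \<in> bowen_ball T (n l) (\<epsilon> l) ((T ^^ ((i - 1) * n l)) p) \<inter> Per T)"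
    using locally_independent_imp_indep_shadows[OF assms(11) finQ neQ assms(5) assms(12)] by metis
  then obtain x where
    indep: "\<And>l. prob_space.indep_vars (?q l) (\<lambda>_. count_space UNIV) (x l) {1..k l}" and
    shadow: "\<And>l i p. i \<in> {1..k l} \<Longrightarrow> p \<in> Q l \<Longrightarrow>
      x l i p \<in> bowen_ball T (n l) (\<epsilon> l) ((T ^^ ((i - 1) * n l)) p) \<inter> Per T"
    by metis
  define c where "c l i = unif_expectation (Q l) (Y l i)" for l i
  define U where "U l i p = (Y l i p - c l i) / s l" for l i p
  \<comment> \<open>\<open>V\<close> is centred with the mean of \<open>Y\<close>, not with its own: a shift by constants preserves
      independence, and the constants cancel in \<open>U - V\<close>.\<close>
  define V where "V l i p = (birkhoff_sum T (h l i) 0 (n l) (x l i p) - c l i) / s l" for l i p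
  define \<omega> where "\<omega> l i = oscillation T (h l i) (\<epsilon> l) ((i - 1) * n l) (n l)" for l i
  define W where "W l = (\<Sum>i=1..k l. unif_expectation (Q l) (\<lambda>p. \<bar>U l i p - V l i p\<bar>))" for l

  have W_le: "ennreal (W l) \<le> (\<Sum>i=1..k l. \<integral>\<^sup>+ p. \<omega> l i p ^ 1 \<partial>?q l) / ennreal (s l ^ 1)" for l
  proof -
    have "ennreal (W l) = (\<Sum>i=1..k l. ennreal (unif_expectation (Q l) (\<lambda>p. \<bar>U l i p - V l i p\<bar>)))"
      unfolding W_def by (rule sum_ennreal[symmetric]) simp
    also have "\<dots> \<le> (\<Sum>i=1..k l. (\<integral>\<^sup>+ p. \<omega> l i p \<partial>?q l) / ennreal (s l))"
    proof (intro sum_mono)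
      fix i assume i: "i \<in> {1..k l}"
      have "ennreal (unif_expectation (Q l) (\<lambda>p. \<bar>U l i p - V l i p\<bar>)) =
          (\<integral>\<^sup>+ p. ennreal \<bar>U l i p - V l i p\<bar> \<partial>?q l)"
        by (rule nn_integral_eq_integral[symmetric]) (auto simp: int)
      also have "\<dots> \<le> (\<integral>\<^sup>+ p. \<omega> l i p / ennreal (s l) \<partial>?q l)"
      proof (intro nn_integral_mono_AE AE_pmfI)
        fix p assume "p \<in> set_pmf (pmf_of_set (Q l))"
        then have p: "p \<in> Q l" by (simp add: finQ neQ)
        have "U l i p - V l i p = (Y l i p - birkhoff_sum T (h l i) 0 (n l) (x l i p)) / s l"
          by (simp add: U_def V_def diff_divide_distrib)
        then have "ennreal \<bar>U l i p - V l i p\<bar> =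
            ennreal \<bar>Y l i p - birkhoff_sum T (h l i) 0 (n l) (x l i p)\<bar> / ennreal (s l)"
          using spos[of l] by (simp add: abs_divide divide_ennreal)
        also have "ennreal \<bar>Y l i p - birkhoff_sum T (h l i) 0 (n l) (x l i p)\<bar> \<le> \<omega> l i p"
          unfolding Y \<omega>_def oscillation_def by (rule SUP_upper[OF shadow[OF i p]])
        finally show "ennreal \<bar>U l i p - V l i p\<bar> \<le> \<omega> l i p / ennreal (s l)"
          by (simp add: divide_right_mono_ennreal)
      qed
      also have "\<dots> = (\<integral>\<^sup>+ p. \<omega> l i p \<partial>?q l) / ennreal (s l)"
        by (rule nn_integral_divide) simp
      finally show "ennreal (unif_expectation (Q l) (\<lambda>p. \<bar>U l i p - V l i p\<bar>)) \<le>
        (\<integral>\<^sup>+ p. \<omega> l i p \<partial>?q l) / ennreal (s l)" .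
    qed
    also have "\<dots> = (\<Sum>i=1..k l. \<integral>\<^sup>+ p. \<omega> l i p ^ 1 \<partial>?q l) / ennreal (s l ^ 1)"
      by (simp add: divide_ennreal_def sum_distrib_right)
    finally show ?thesis .
  qed
  have "(\<lambda>l. ennreal (W l)) \<longlonglongrightarrow> 0"
    using tendsto_sandwich[OF _ always_eventually[OF allI[OF W_le]] tendsto_const[of 0]]
      assms(16)[of 1] unfolding \<omega>_def by simp
  then have W: "W \<longlonglongrightarrow> 0"
    by (subst (asm) ennreal_tendsto_0_iff) (auto simp: W_def intro!: sum_nonneg)

  interpret arr: asymptotically_independent_array ?q "\<lambda>l. {1..k l}" U
  proof (rule asymptotically_independent_array.intro)
    fix l i t
    show "prob_space (?q l)" by (rule measure_pmf.prob_space_axioms)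
    show "finite {1..k l}" "{1..k l} \<noteq> {}" using assms(5)[of l] by auto
    show "U l i \<in> borel_measurable (?q l)" by simp
    show "integrable (?q l) (\<lambda>p. (U l i p)\<^sup>2)" by (rule int)
    show "(\<integral>p. U l i p \<partial>?q l) = 0"
      by (simp add: U_def int c_def measure_pmf.prob_space)
    have "(\<Sum>i=1..k l. \<integral>p. (U l i p)\<^sup>2 \<partial>?q l) = (\<Sum>i=1..k l. unif_variance (Q l) (Y l i)) / (s l)\<^sup>2"
      by (simp add: U_def c_def power_divide sum_divide_distrib)
    also have "(\<Sum>i=1..k l. unif_variance (Q l) (Y l i)) = (s l)\<^sup>2"
      unfolding s by (subst real_sqrt_pow2) (auto intro!: sum_nonneg Bochner_Integration.integral_nonneg)
    finally show "(\<Sum>i=1..k l. \<integral>p. (U l i p)\<^sup>2 \<partial>?q l) = 1"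
      using spos[of l] by simp
    show "(\<lambda>l. char (distr (?q l) borel (\<lambda>p. \<Sum>i=1..k l. U l i p)) t
        - (\<Prod>i=1..k l. char (distr (?q l) borel (U l i)) t)) \<longlonglongrightarrow> 0"
    proof (rule Lim_null_comparison)
      show "(\<lambda>l. 2 * \<bar>t\<bar> * W l) \<longlonglongrightarrow> 0"
        by (rule tendsto_mult_right_zero[OF W])
      have "prob_space.indep_vars (?q l) (\<lambda>_. borel) (V l) {1..k l}" for l
        unfolding V_def[abs_def]
        by (rule prob_space.indep_vars_compose2[OF measure_pmf.prob_space_axioms indep]) simp
      then show "\<forall>\<^sub>F l in sequentially. cmod (char (distr (?q l) borel (\<lambda>p. \<Sum>i=1..k l. U l i p)) t
          - (\<Prod>i=1..k l. char (distr (?q l) borel (U l i)) t)) \<le> 2 * \<bar>t\<bar> * W l"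
        unfolding W_def
        by (intro always_eventually allI measure_pmf.char_sum_near_prod_of_indep int) auto
    qed
  qed

  have "lindeberg_fun (Q l) (Y l i) (\<eta> * s l) / (s l)\<^sup>2 =
      (\<integral>p. (U l i p)\<^sup>2 * indicator {p. \<eta> < \<bar>U l i p\<bar>} p \<partial>?q l)" for l i \<eta>
    unfolding lindeberg_fun_def integral_divide_zero[symmetric] U_def c_def
    using spos[of l]
    by (intro Bochner_Integration.integral_cong) (auto simp: indicator_def power_divide field_simps)
  then have "(\<forall>\<eta>>0. (\<lambda>l. (\<Sum>i=1..k l. lindeberg_fun (Q l) (Y l i) (\<eta> * s l)) / (s l)\<^sup>2) \<longlonglongrightarrow> 0)
      \<longleftrightarrow> arr.lindeberg"
    unfolding arr.lindeberg_def sum_divide_distrib by simp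
  moreover have "{p. \<bar>Y l i p - unif_expectation (Q l) (Y l i)\<bar> \<ge> \<eta> * s l} = {p. \<eta> \<le> \<bar>U l i p\<bar>}" for l i \<eta>
    using spos[of l] by (simp add: U_def c_def field_simps)
  moreover have "{p. (\<Sum>i=1..k l. Y l i p - unif_expectation (Q l) (Y l i)) \<le> t * s l} =
      {p. (\<Sum>i=1..k l. U l i p) \<le> t}" for l t
    using spos[of l] by (simp add: U_def c_def field_simps flip: sum_divide_distrib)
  ultimately show ?thesis
    using arr.lindeberg_iff unfolding arr.negligible_terms_def arr.normal_limit_def by simp
qed

end
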